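(* (1) Let $P$ and $Q$ be vertex-colored posets with vertices colored by a set $I$. Suppose that for each $i\in I$ the vertices of color $i$ in $Q$ coincide with the vertices of color $i$ in $P$, and suppose that $Q$ is a weak subposet of $P$. Let $K:=\mathbf J_{color}(P)$ and $L:=\mathbf J_{color}(Q)$. Then $K$ is a full-length edge-colored sublattice of $L$. (2) Conversely, suppose $L$ is a diamond-colored distributive lattice with edges colored by a set $I$, with full-length sublattice $K$. Let $Q:=\mathbf j_{color}(L)$ and $P:=\mathbf j_{color}(K)$. (a) For any join irreducible $\mathbf x$ in $L$, the set $\{\mathbf y\in K\mid \mathbf x\le_L\mathbf y\}$ has a unique minimal element $\mathbf w_{\mathbf x}$, and $\mathbf w_{\mathbf x}$ is a join irreducible in $K$. (b) The function $\phi:Q\to P$ given by $\phi(\mathbf x):=\mathbf w_{\mathbf x}$ is a vertex-color-preserving bijection, and if $\mathbf u\le_Q\mathbf v$ then $\phi(\mathbf u)\le_P\phi(\mathbf v)$. Now let $Q'$ be the set $P$ and declare that $\phi(\mathbf u)\le_{Q'}\phi(\mathbf v)$ if and only if $\mathbf u\le_Q\mathbf v$. Then $Q'$ is a weak subposet of $P$, and $Q'\cong Q$ as vertex-colored posets.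
   Context: All posets and lattices are finite. $\mathbf x\to\mathbf y$ means that $\mathbf y$ covers $\mathbf x$. A poset is vertex-colored (edge-colored) by $I$ if each element (each covering edge) is assigned a color in $I$. An edge-colored poset is diamond-colored if, whenever $\mathbf v\to\mathbf s$, $\mathbf v\to\mathbf t$, $\mathbf s\to\mathbf u$, $\mathbf t\to\mathbf u$ with $\mathbf s\ne\mathbf t$, the edges $\mathbf v\to\mathbf s$ and $\mathbf t\to\mathbf u$ have the same color and the edges $\mathbf v\to\mathbf t$ and $\mathbf s\to\mathbf u$ have the same color. $Q$ is a weak subposet of $P$ if $Q\subseteq P$ as sets and $u\le_Q v$ implies $u\le_P v$. A sublattice of $L$ is a nonempty subset closed under the joins and meets of $L$, with the induced order. A sublattice $K$ of $L$ is full-length if $K$ and $L$ are both ranked and have the same length (length of a longest chain). In that case every covering edge of $K$ is a covering edge of $L$. $K$ is an edge-colored sublattice of $L$ if it is a sublattice whose edges are edges of $L$ with the same colors. In part (2), $K$ carries the edge colors inherited from $L$. $\mathbf J_{color}(P)$ is the set of order ideals (down-closed subsets) of the vertex-colored poset $P$ ordered by inclusion, where an edge $\mathbf x\to\mathbf y$ with $\mathbf y-\mathbf x=\{v\}$ gets the color of $v$. $\mathbf j_{color}(L)$ is the set of join irreducible elements of $L$ (those covering exactly one element) with the induced order, where a join irreducible $\mathbf x$ covering $\mathbf x'$ is colored by the color of $\mathbf x'\to\mathbf x$. The vertex colors of $Q'$ are those of $P$. *)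

theory Defs
  imports "HOL-Algebra.Lattice"
begin

record ('a, 'i) vcposet = "'a gorder" +
  vcolor :: "'a \<Rightarrow> 'i"

text \<open>The value \<open>ecolor L x y\<close> is only meaningful when \<open>y\<close> covers \<open>x\<close>.\<close>

record ('a, 'i) ecposet = "'a gorder" +
  ecolor :: "'a \<Rightarrow> 'a \<Rightarrow> 'i"

text \<open>\<open>covers P x y\<close> is the covering edge from \<open>x\<close> to \<open>y\<close>: the larger element comes second.\<close>

definition covers :: "('a, 'm) gorder_scheme \<Rightarrow> 'a \<Rightarrow> 'a \<Rightarrow> bool" where
  "covers P x y \<longleftrightarrow> x \<in> carrier P \<and> y \<in> carrier P \<and> x \<sqsubset>\<^bsub>P\<^esub> y \<and>
     \<not> (\<exists>z\<in>carrier P. x \<sqsubset>\<^bsub>P\<^esub> z \<and> z \<sqsubset>\<^bsub>P\<^esub> y)"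

definition vertex_colored_poset :: "'i set \<Rightarrow> ('a, 'i) vcposet \<Rightarrow> bool" where
  "vertex_colored_poset I P \<longleftrightarrow>
     partial_order P \<and> finite (carrier P) \<and> (\<forall>x\<in>carrier P. vcolor P x \<in> I)"

definition edge_colored_poset :: "'i set \<Rightarrow> ('a, 'i) ecposet \<Rightarrow> bool" where
  "edge_colored_poset I L \<longleftrightarrow>
     partial_order L \<and> finite (carrier L) \<and> (\<forall>x y. covers L x y \<longrightarrow> ecolor L x y \<in> I)"

definition diamond_colored :: "('a, 'i) ecposet \<Rightarrow> bool" where
  "diamond_colored L \<longleftrightarrow>
     (\<forall>v s t u. covers L v s \<and> covers L v t \<and> covers L s u \<and> covers L t u \<and> s \<noteq> t \<longrightarrow>
        ecolor L v s = ecolor L t u \<and> ecolor L v t = ecolor L s u)"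

locale distributive_lattice = lattice +
  assumes meet_join_distrib:
    "\<lbrakk>x \<in> carrier L; y \<in> carrier L; z \<in> carrier L\<rbrakk>
       \<Longrightarrow> x \<sqinter> (y \<squnion> z) = (x \<sqinter> y) \<squnion> (x \<sqinter> z)"

definition diamond_colored_distributive_lattice :: "'i set \<Rightarrow> ('a, 'i) ecposet \<Rightarrow> bool" where
  "diamond_colored_distributive_lattice I L \<longleftrightarrow>
     distributive_lattice L \<and> edge_colored_poset I L \<and> diamond_colored L"

definition weak_subposet :: "('a, 'm) gorder_scheme \<Rightarrow> ('a, 'n) gorder_scheme \<Rightarrow> bool" where
  "weak_subposet Q P \<longleftrightarrow> partial_order Q \<and> partial_order P \<and> carrier Q \<subseteq> carrier P \<and>
     (\<forall>u\<in>carrier Q. \<forall>v\<in>carrier Q. u \<sqsubseteq>\<^bsub>Q\<^esub> v \<longrightarrow> u \<sqsubseteq>\<^bsub>P\<^esub> v)"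

text \<open>The relation symbols of \<open>K\<close> and \<open>L\<close> need not agree outside the carrier of \<open>K\<close>.\<close>

definition sublattice :: "('a, 'm) gorder_scheme \<Rightarrow> ('a, 'n) gorder_scheme \<Rightarrow> bool" where
  "sublattice K L \<longleftrightarrow> lattice L \<and> partial_order K \<and> carrier K \<noteq> {} \<and> carrier K \<subseteq> carrier L \<and>
     (\<forall>x\<in>carrier K. \<forall>y\<in>carrier K. x \<sqsubseteq>\<^bsub>K\<^esub> y \<longleftrightarrow> x \<sqsubseteq>\<^bsub>L\<^esub> y) \<and>
     (\<forall>x\<in>carrier K. \<forall>y\<in>carrier K. x \<squnion>\<^bsub>L\<^esub> y \<in> carrier K \<and> x \<sqinter>\<^bsub>L\<^esub> y \<in> carrier K)"

text \<open>Ranked means that there is a rank function onto an initial segment \<open>{0, ..., l}\<close> of the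
  natural numbers which increases by one along every covering edge.\<close>

definition ranked :: "('a, 'm) gorder_scheme \<Rightarrow> bool" where
  "ranked P \<longleftrightarrow> (\<exists>(\<rho> :: 'a \<Rightarrow> nat) l. \<rho> ` carrier P = {0..l} \<and>
     (\<forall>x y. covers P x y \<longrightarrow> \<rho> y = \<rho> x + 1))"

text \<open>A chain with \<open>n\<close> elements has length \<open>n - 1\<close>.\<close>

definition poset_length :: "('a, 'm) gorder_scheme \<Rightarrow> nat" where
  "poset_length P = Max {card C - 1 | C. C \<noteq> {} \<and> pred_on.chain (carrier P) (le P) C}"

definition full_length_sublattice ::
    "('a, 'm) gorder_scheme \<Rightarrow> ('a, 'n) gorder_scheme \<Rightarrow> bool" where
  "full_length_sublattice K L \<longleftrightarrow>
     sublattice K L \<and> ranked K \<and> ranked L \<and> poset_length K = poset_length L"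

definition edge_colored_sublattice :: "('a, 'i) ecposet \<Rightarrow> ('a, 'i) ecposet \<Rightarrow> bool" where
  "edge_colored_sublattice K L \<longleftrightarrow> sublattice K L \<and>
     (\<forall>x y. covers K x y \<longrightarrow> covers L x y \<and> ecolor K x y = ecolor L x y)"

definition order_ideals :: "('a, 'm) gorder_scheme \<Rightarrow> 'a set set" where
  "order_ideals P =
     {X. X \<subseteq> carrier P \<and> (\<forall>v\<in>X. \<forall>u\<in>carrier P. u \<sqsubseteq>\<^bsub>P\<^esub> v \<longrightarrow> u \<in> X)}"

text \<open>In a finite poset, \<open>Y - X\<close> is a singleton whenever the order ideal \<open>Y\<close> covers \<open>X\<close>.\<close>

definition J_color :: "('a, 'i) vcposet \<Rightarrow> ('a set, 'i) ecposet" where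
  "J_color P = \<lparr>carrier = order_ideals P, eq = (=), le = (\<subseteq>),
     ecolor = (\<lambda>X Y. vcolor P (the_elem (Y - X)))\<rparr>"

definition join_irreducibles :: "('a, 'm) gorder_scheme \<Rightarrow> 'a set" where
  "join_irreducibles L = {x \<in> carrier L. \<exists>!x'. covers L x' x}"

definition j_color :: "('a, 'i) ecposet \<Rightarrow> ('a, 'i) vcposet" where
  "j_color L = \<lparr>carrier = join_irreducibles L, eq = (=), le = le L,
     vcolor = (\<lambda>x. ecolor L (THE x'. covers L x' x) x)\<rparr>"

definition minimal_in :: "('a, 'm) gorder_scheme \<Rightarrow> 'a set \<Rightarrow> 'a \<Rightarrow> bool" where
  "minimal_in P A w \<longleftrightarrow> w \<in> A \<and> (\<forall>y\<in>A. y \<sqsubseteq>\<^bsub>P\<^esub> w \<longrightarrow> y = w)"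

text \<open>The element \<open>w\<^sub>x\<close>; as a definite description it is only meaningful when
  the minimal element exists and is unique.\<close>

definition w_elem :: "('a, 'm) gorder_scheme \<Rightarrow> ('a, 'n) gorder_scheme \<Rightarrow> 'a \<Rightarrow> 'a" where
  "w_elem K L x = (THE w. minimal_in K {y \<in> carrier K. x \<sqsubseteq>\<^bsub>L\<^esub> y} w)"

definition vc_isomorphic :: "('a, 'i) vcposet \<Rightarrow> ('b, 'i) vcposet \<Rightarrow> bool" where
  "vc_isomorphic A B \<longleftrightarrow> (\<exists>f. bij_betw f (carrier A) (carrier B) \<and> order_emb A B f \<and>
     (\<forall>x\<in>carrier A. vcolor B (f x) = vcolor A x))"

end

theory Submission
  imports Defs
begin

text \<open>
  Order ideals. If \<open>Q\<close> has the vertices of \<open>P\<close> and only some of its relations, then every order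
  ideal of \<open>P\<close> is one of \<open>Q\<close>. Joins and meets are unions and intersections in both lattices, and
  cardinality is a rank function of both, so both have the number of vertices as length
  (\<open>ranked_directed_J_color\<close>). An edge adds a single vertex, and the vertex colors of \<open>P\<close> and \<open>Q\<close>
  agree (\<open>J_color_full_length_edge_colored_sublattice\<close>).

  Join irreducibles. Say that \<open>x\<close> crosses the edge from \<open>v\<close> to \<open>w\<close> if \<open>x\<close> is below \<open>w\<close> and not
  below \<open>v\<close>. In a finite distributive lattice \<open>L\<close> every edge is crossed by exactly one join
  irreducible element: a minimal crossing element is join irreducible
  (\<open>join_irreducible_separates\<close>), and uniqueness holds because join irreducibles are join prime
  (\<open>join_irreducible_of_cover_unique\<close>). In the diamond-colored case the edge crossed by \<open>x\<close> has
  the color of the edge that ends in \<open>x\<close>, because a ladder of diamonds joins these two edges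
  (\<open>color_of_cover\<close>).

  A full-length sublattice \<open>K\<close> has the same rank function as \<open>L\<close>
  (\<open>full_length_common_rank\<close>). Therefore its edges are edges of \<open>L\<close>, and it contains the bottom and
  the top of \<open>L\<close>. Since \<open>K\<close> is closed under meets, the elements of \<open>K\<close> above \<open>x\<close> have
  a least one, which is \<open>w\<^sub>x\<close>. As \<open>x\<close> is below no element of \<open>K\<close> strictly below \<open>w\<^sub>x\<close>, it
  crosses every edge of \<open>K\<close> that ends in \<open>w\<^sub>x\<close>. Two such edges would exhibit \<open>w\<^sub>x\<close> as a join of
  elements not above the join prime \<open>x\<close>, so there is just one, and \<open>w\<^sub>x\<close> is join irreducible in
  \<open>K\<close>. Thus \<open>x\<close> and \<open>w\<^sub>x\<close> determine each other: \<open>x\<close> is the join irreducible of \<open>L\<close> crossing the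
  unique edge of \<open>K\<close> that ends in \<open>w\<^sub>x\<close>. This gives the bijection (\<open>w_elem_bij\<close>), and the color of
  that edge is the color of both \<open>x\<close> and \<open>w\<^sub>x\<close> (\<open>w_elem_color\<close>).
\<close>

section \<open>Covering edges and rank functions\<close>

lemma (in partial_order) covers_iff:
  "covers L x y \<longleftrightarrow> x \<in> carrier L \<and> y \<in> carrier L \<and> x \<sqsubseteq> y \<and> x \<noteq> y \<and>
     (\<forall>z\<in>carrier L. x \<sqsubseteq> z \<longrightarrow> z \<sqsubseteq> y \<longrightarrow> z = x \<or> z = y)"
  unfolding covers_def lless_eq by blast

lemma (in partial_order) lless_asymp: "asymp_on (carrier L) (\<sqsubset>)"
  by (rule asymp_onI) (blast intro: lless_antisym)

lemma (in partial_order) lless_transp: "transp_on (carrier L) (\<sqsubset>)"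
  by (rule transp_onI) (rule lless_trans)

lemma (in partial_order) obtains_minimal:
  assumes "finite A" "A \<subseteq> carrier L" "A \<noteq> {}"
  obtains m where "m \<in> A" "\<And>x. x \<in> A \<Longrightarrow> x \<sqsubseteq> m \<Longrightarrow> x = m"
proof -
  have "asymp_on A (\<sqsubset>)" "transp_on A (\<sqsubset>)"
    using asymp_on_subset[OF lless_asymp assms(2)] transp_on_subset[OF lless_transp assms(2)] .
  from Finite_Set.bex_min_element[OF assms(1) this assms(3)] that show ?thesis
    unfolding lless_eq by blast
qed

lemma (in partial_order) obtains_maximal:
  assumes "finite A" "A \<subseteq> carrier L" "A \<noteq> {}"
  obtains m where "m \<in> A" "\<And>x. x \<in> A \<Longrightarrow> m \<sqsubseteq> x \<Longrightarrow> x = m"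
proof -
  have "asymp_on A (\<sqsubset>)" "transp_on A (\<sqsubset>)"
    using asymp_on_subset[OF lless_asymp assms(2)] transp_on_subset[OF lless_transp assms(2)] .
  from Finite_Set.bex_max_element[OF assms(1) this assms(3)] that show ?thesis
    unfolding lless_eq by blast
qed

lemma (in partial_order) obtains_lower_cover:
  assumes "finite (carrier L)" "x \<in> carrier L" "y \<in> carrier L" "x \<sqsubseteq> y" "x \<noteq> y"
  obtains z where "covers L z y" "x \<sqsubseteq> z"
proof -
  let ?A = "{z \<in> carrier L. x \<sqsubseteq> z \<and> z \<sqsubseteq> y \<and> z \<noteq> y}"
  have "finite ?A" "?A \<subseteq> carrier L" "?A \<noteq> {}"
    using assms by auto
  then obtain m where m: "m \<in> ?A" "\<And>z. z \<in> ?A \<Longrightarrow> m \<sqsubseteq> z \<Longrightarrow> z = m"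
    by (rule obtains_maximal) blast
  have "z = m \<or> z = y" if z: "z \<in> carrier L" "m \<sqsubseteq> z" "z \<sqsubseteq> y" for z
  proof (cases "z = y")
    case False
    have "x \<sqsubseteq> z"
      using m(1) z assms(2) by (auto intro: le_trans[of x m z])
    then show ?thesis
      using m(2) z False by auto
  qed simp
  then show ?thesis
    using that[of m] m(1) assms(3) by (auto simp: covers_iff)
qed

text \<open>In a finite poset every \<open>x \<sqsubseteq> y\<close> is refined by a saturated chain; this is induction along
  such a chain.\<close>

lemma (in partial_order) saturated_chain_induct [consumes 4, case_names base step]:
  assumes "finite (carrier L)" "x \<in> carrier L" "y \<in> carrier L" and "x \<sqsubseteq> y"
    and base: "P x"
    and step: "\<And>z y. covers L z y \<Longrightarrow> x \<sqsubseteq> z \<Longrightarrow> P z \<Longrightarrow> P y"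
  shows "P y"
  using assms(3,4)
proof (induction "card {u \<in> carrier L. u \<sqsubseteq> y}" arbitrary: y rule: less_induct)
  case less
  show ?case
  proof (cases "x = y")
    case False
    then obtain z where z: "covers L z y" "x \<sqsubseteq> z"
      using obtains_lower_cover assms(1,2) less.prems by metis
    then have zy: "z \<in> carrier L" "z \<sqsubseteq> y" "z \<noteq> y"
      by (auto simp: covers_iff)
    have "{u \<in> carrier L. u \<sqsubseteq> z} \<subset> {u \<in> carrier L. u \<sqsubseteq> y}"
    proof
      show "{u \<in> carrier L. u \<sqsubseteq> z} \<subseteq> {u \<in> carrier L. u \<sqsubseteq> y}"
        using zy less.prems(1) by (auto intro: le_trans[of _ z y])
      show "{u \<in> carrier L. u \<sqsubseteq> z} \<noteq> {u \<in> carrier L. u \<sqsubseteq> y}"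
        using zy less.prems(1) le_antisym[of z y] by auto
    qed
    then have "card {u \<in> carrier L. u \<sqsubseteq> z} < card {u \<in> carrier L. u \<sqsubseteq> y}"
      using assms(1) by (intro psubset_card_mono) auto
    from step[OF z less.hyps[OF this zy(1) z(2)]] show ?thesis .
  qed (use base in simp)
qed

text \<open>The two bounds say, for a finite nonempty poset, that there is a bottom and a top. In this form they
  are immediate for lattices and for subsets closed under joins and meets.\<close>

locale ranked_directed_poset = partial_order +
  fixes \<rho> :: "'a \<Rightarrow> nat" and l :: nat
  assumes finite_carrier: "finite (carrier L)"
    and rank_image: "\<rho> ` carrier L = {0..l}"
    and rank_cover: "covers L x y \<Longrightarrow> \<rho> y = \<rho> x + 1"
    and lower_bound: "x \<in> carrier L \<Longrightarrow> y \<in> carrier L \<Longrightarrow> \<exists>z\<in>carrier L. z \<sqsubseteq> x \<and> z \<sqsubseteq> y"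
    and upper_bound: "x \<in> carrier L \<Longrightarrow> y \<in> carrier L \<Longrightarrow> \<exists>z\<in>carrier L. x \<sqsubseteq> z \<and> y \<sqsubseteq> z"
begin

lemma rank_le: "x \<in> carrier L \<Longrightarrow> \<rho> x \<le> l"
  using rank_image by auto

lemma rank_strict_mono:
  assumes "x \<in> carrier L" "y \<in> carrier L" "x \<sqsubseteq> y" "x \<noteq> y"
  shows "\<rho> x < \<rho> y"
proof -
  from finite_carrier assms(1-3) have "\<rho> x \<le> \<rho> y \<and> (x \<noteq> y \<longrightarrow> \<rho> x < \<rho> y)"
    by (induction rule: saturated_chain_induct) (auto dest: rank_cover)
  then show ?thesis
    using assms(4) by simp
qed

text \<open>A saturated chain from \<open>x\<close> to \<open>y\<close> has \<open>\<rho> y - \<rho> x\<close> edges, and \<open>\<sigma>\<close> grows by at least one along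
  each of them.\<close>

lemma rank_difference_le:
  fixes \<sigma> :: "'a \<Rightarrow> nat"
  assumes mono: "\<And>u v. u \<in> carrier L \<Longrightarrow> v \<in> carrier L \<Longrightarrow> u \<sqsubseteq> v \<Longrightarrow> u \<noteq> v \<Longrightarrow> \<sigma> u < \<sigma> v"
    and "x \<in> carrier L" "y \<in> carrier L" "x \<sqsubseteq> y"
  shows "\<rho> y + \<sigma> x \<le> \<sigma> y + \<rho> x"
  using finite_carrier assms(2-)
proof (induction rule: saturated_chain_induct)
  case (step z y)
  then have "\<rho> y = \<rho> z + 1" "\<sigma> z < \<sigma> y"
    using rank_cover mono by (auto simp: covers_iff)
  then show ?case
    using step by simp
qed simp

lemma rank_0_is_least:
  assumes "b \<in> carrier L" "\<rho> b = 0" "x \<in> carrier L"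
  shows "b \<sqsubseteq> x"
proof -
  obtain z where "z \<in> carrier L" "z \<sqsubseteq> b" "z \<sqsubseteq> x"
    using lower_bound assms by blast
  then show ?thesis
    using rank_strict_mono[of z b] assms by auto
qed

lemma rank_l_is_greatest:
  assumes "t \<in> carrier L" "\<rho> t = l" "x \<in> carrier L"
  shows "x \<sqsubseteq> t"
proof -
  obtain z where "z \<in> carrier L" "t \<sqsubseteq> z" "x \<sqsubseteq> z"
    using upper_bound assms by blast
  then show ?thesis
    using rank_strict_mono[of t z] rank_le[of z] assms by auto
qed

lemma obtains_rank_0:
  obtains b where "b \<in> carrier L" "\<rho> b = 0"
proof -
  have "0 \<in> \<rho> ` carrier L" by (simp add: rank_image)
  then show ?thesis using that by auto
qed

lemma obtains_rank_l:
  obtains t where "t \<in> carrier L" "\<rho> t = l"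
proof -
  have "l \<in> \<rho> ` carrier L" by (simp add: rank_image)
  then show ?thesis using that by auto
qed

lemma covers_if_rank_Suc:
  assumes "x \<in> carrier L" "y \<in> carrier L" "x \<sqsubseteq> y" "\<rho> y = \<rho> x + 1"
  shows "covers L x y"
proof -
  have "z = x \<or> z = y" if "z \<in> carrier L" "x \<sqsubseteq> z" "z \<sqsubseteq> y" for z
    using rank_strict_mono[of x z] rank_strict_mono[of z y] that assms by force
  then show ?thesis
    using assms by (auto simp: covers_iff)
qed

text \<open>A chain meets each of the \<open>l + 1\<close> ranks at most once, and a saturated chain from the bottom
  to the top meets each of them.\<close>

lemma poset_length_eq: "poset_length L = l"
proof -
  let ?N = "{card C - 1 | C. C \<noteq> {} \<and> pred_on.chain (carrier L) (\<sqsubseteq>) C}"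
  have bound: "n \<le> l" if "n \<in> ?N" for n
  proof -
    from that obtain C where n: "n = card C - 1" and C: "pred_on.chain (carrier L) (\<sqsubseteq>) C"
      by blast
    then have sub: "C \<subseteq> carrier L"
      and tot: "\<And>x y. x \<in> C \<Longrightarrow> y \<in> C \<Longrightarrow> x \<noteq> y \<Longrightarrow> x \<sqsubseteq> y \<or> y \<sqsubseteq> x"
      by (auto simp: pred_on.chain_def)
    have "inj_on \<rho> C"
    proof (rule inj_onI, rule ccontr)
      fix x y
      assume "x \<in> C" "y \<in> C" "\<rho> x = \<rho> y" "x \<noteq> y"
      then show False
        using tot[of x y] rank_strict_mono[of x y] rank_strict_mono[of y x] sub by auto
    qed
    then have "card C \<le> card {0..l}"
      using sub rank_image by (intro card_inj_on_le) auto
    then show ?thesis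
      using n by simp
  qed
  obtain b t where b: "b \<in> carrier L" "\<rho> b = 0" and t: "t \<in> carrier L" "\<rho> t = l"
    using obtains_rank_0 obtains_rank_l by metis
  have "b \<sqsubseteq> t"
    using rank_0_is_least[OF b t(1)] .
  with finite_carrier b(1) t(1)
  have "\<exists>C. pred_on.chain (carrier L) (\<sqsubseteq>) C \<and> t \<in> C \<and> (\<forall>z\<in>C. z \<sqsubseteq> t) \<and> card C = \<rho> t + 1"
  proof (induction rule: saturated_chain_induct)
    case base
    then show ?case
      using b by (intro exI[of _ "{b}"]) (auto simp: pred_on.chain_def)
  next
    case (step z y)
    from step.IH obtain C where C: "pred_on.chain (carrier L) (\<sqsubseteq>) C" "z \<in> C" "\<forall>u\<in>C. u \<sqsubseteq> z"
      "card C = \<rho> z + 1" by blast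
    from step.hyps have zy: "z \<in> carrier L" "y \<in> carrier L" "z \<sqsubseteq> y" "z \<noteq> y"
      by (auto simp: covers_iff)
    have sub: "C \<subseteq> carrier L"
      using C(1) by (auto simp: pred_on.chain_def)
    have le: "u \<sqsubseteq> y" if "u \<in> C" for u
      using that C(3) sub zy le_trans[of u z y] by auto
    have "y \<notin> C"
      using C(3) zy le_antisym by blast
    moreover have "finite C"
      using sub finite_carrier by (rule finite_subset)
    moreover have "pred_on.chain (carrier L) (\<sqsubseteq>) (insert y C)"
      using C(1) zy le by (auto simp: pred_on.chain_def)
    ultimately show ?case
      using C(4) le zy rank_cover[OF step.hyps(1)] by (intro exI[of _ "insert y C"]) auto
  qed
  then obtain C where "pred_on.chain (carrier L) (\<sqsubseteq>) C" "t \<in> C" "card C = l + 1"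
    using t by auto
  then have "l \<in> ?N"
    by (intro CollectI exI[of _ C]) auto
  moreover have "?N \<subseteq> {0..l}"
    using bound by (meson atLeastAtMost_iff subsetI zero_le)
  then have "finite ?N"
    by (rule finite_subset) simp
  ultimately show ?thesis
    unfolding poset_length_def using bound by (intro Max_eqI) auto
qed

end

section \<open>Lattices of order ideals\<close>

lemma J_color_simps [simp]:
  "carrier (J_color P) = order_ideals P" "eq (J_color P) = (=)" "le (J_color P) = (\<subseteq>)"
  "ecolor (J_color P) X Y = vcolor P (the_elem (Y - X))"
  by (simp_all add: J_color_def)

lemma partial_order_J_color: "partial_order (J_color P)"
  by unfold_locales auto

lemma order_ideals_Un: "X \<in> order_ideals P \<Longrightarrow> Y \<in> order_ideals P \<Longrightarrow> X \<union> Y \<in> order_ideals P"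
  and order_ideals_Int: "X \<in> order_ideals P \<Longrightarrow> Y \<in> order_ideals P \<Longrightarrow> X \<inter> Y \<in> order_ideals P"
  by (auto simp: order_ideals_def)

lemma least_J_color:
  assumes "X \<in> order_ideals P" "Y \<in> order_ideals P"
  shows "least (J_color P) (X \<union> Y) (Upper (J_color P) {X, Y})"
  using assms order_ideals_Un[OF assms] by (auto simp: least_def Upper_def)

lemma greatest_J_color:
  assumes "X \<in> order_ideals P" "Y \<in> order_ideals P"
  shows "greatest (J_color P) (X \<inter> Y) (Lower (J_color P) {X, Y})"
  using assms order_ideals_Int[OF assms] by (auto simp: greatest_def Lower_def)

lemma lattice_J_color: "lattice (J_color P)"
proof -
  interpret partial_order "J_color P"
    by (rule partial_order_J_color)
  show ?thesis
    by unfold_locales (auto intro: least_J_color greatest_J_color)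
qed

lemma join_meet_J_color:
  assumes "X \<in> order_ideals P" "Y \<in> order_ideals P"
  shows "X \<squnion>\<^bsub>J_color P\<^esub> Y = X \<union> Y" "X \<sqinter>\<^bsub>J_color P\<^esub> Y = X \<inter> Y"
proof -
  interpret lattice "J_color P"
    by (rule lattice_J_color)
  show "X \<squnion>\<^bsub>J_color P\<^esub> Y = X \<union> Y"
    by (rule joinI) (use assms least_unique[OF _ least_J_color[OF assms]] in auto)
  show "X \<sqinter>\<^bsub>J_color P\<^esub> Y = X \<inter> Y"
    by (rule meetI) (use assms greatest_unique[OF _ greatest_J_color[OF assms]] in auto)
qed

text \<open>A minimal vertex of \<open>Y - X\<close> can be added to \<open>X\<close>.\<close>

lemma order_ideal_insert:
  assumes "partial_order P" "finite (carrier P)"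
    and X: "X \<in> order_ideals P" and Y: "Y \<in> order_ideals P" and XY: "X \<subset> Y"
  obtains v where "v \<in> Y" "v \<notin> X" "insert v X \<in> order_ideals P"
proof -
  interpret partial_order P by fact
  have sub: "Y \<subseteq> carrier P"
    using Y by (simp add: order_ideals_def)
  then have "finite (Y - X)" "Y - X \<subseteq> carrier P" "Y - X \<noteq> {}"
    using XY finite_subset[OF _ assms(2)] by auto
  then obtain v where v: "v \<in> Y - X" "\<And>u. u \<in> Y - X \<Longrightarrow> u \<sqsubseteq>\<^bsub>P\<^esub> v \<Longrightarrow> u = v"
    by (rule obtains_minimal) blast
  have "insert v X \<in> order_ideals P"
    using X Y v sub unfolding order_ideals_def by blast
  then show ?thesis
    using that[of v] v by auto
qed

lemma covers_J_color:
  assumes "partial_order P" "finite (carrier P)" and cov: "covers (J_color P) X Y"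
  obtains v where "v \<in> carrier P" "v \<notin> X" "Y = insert v X"
proof -
  interpret J: partial_order "J_color P"
    by (rule partial_order_J_color)
  have X: "X \<in> order_ideals P" and Y: "Y \<in> order_ideals P" and XY: "X \<subset> Y"
    and between: "\<And>Z. Z \<in> order_ideals P \<Longrightarrow> X \<subseteq> Z \<Longrightarrow> Z \<subseteq> Y \<Longrightarrow> Z = X \<or> Z = Y"
    using cov by (auto simp: J.covers_iff)
  obtain v where v: "v \<in> Y" "v \<notin> X" "insert v X \<in> order_ideals P"
    using order_ideal_insert[OF assms(1,2) X Y XY] .
  then have "insert v X = Y"
    using between[of "insert v X"] XY by auto
  then show ?thesis
    using that[of v] v Y by (auto simp: order_ideals_def)
qed

lemma ranked_directed_J_color:
  assumes "partial_order P" "finite (carrier P)"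
  shows "ranked_directed_poset (J_color P) card (card (carrier P))"
proof -
  interpret J: partial_order "J_color P"
    by (rule partial_order_J_color)
  have ideal_finite: "finite X" if "X \<in> order_ideals P" for X
    using that finite_subset[OF _ assms(2)] by (auto simp: order_ideals_def)
  have cover: "card Y = card X + 1" if "covers (J_color P) X Y" for X Y
  proof -
    from covers_J_color[OF assms that] obtain v where "v \<notin> X" "Y = insert v X" .
    moreover have "finite X"
      using that ideal_finite by (auto simp: J.covers_iff)
    ultimately show ?thesis by simp
  qed
  have empty: "{} \<in> order_ideals P" and full: "carrier P \<in> order_ideals P"
    by (auto simp: order_ideals_def)
  have fin: "finite (order_ideals P)"
    using assms(2) by (auto simp: order_ideals_def)
  have sub: "X \<subseteq> carrier P" if "X \<in> order_ideals P" for X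
    using that by (simp add: order_ideals_def)
  have "\<exists>X\<in>order_ideals P. card X = n" if "n \<le> card (carrier P)" for n
    using that
  proof (induction n)
    case 0
    show ?case
      using empty by (rule bexI[rotated]) simp
  next
    case (Suc n)
    then obtain X where X: "X \<in> order_ideals P" "card X = n"
      by auto
    then have "X \<subset> carrier P"
      using sub Suc.prems by auto
    then obtain v where "v \<notin> X" "insert v X \<in> order_ideals P"
      using order_ideal_insert[OF assms X(1) full] by blast
    then show ?case
      using X ideal_finite[OF X(1)] by (intro bexI[of _ "insert v X"]) auto
  qed
  then have image: "card ` order_ideals P = {0..card (carrier P)}"
    using sub card_mono[OF assms(2)] by force
  show ?thesis
  proof
    fix X Y
    assume XY: "X \<in> carrier (J_color P)" "Y \<in> carrier (J_color P)"
    show "\<exists>Z\<in>carrier (J_color P). Z \<sqsubseteq>\<^bsub>J_color P\<^esub> X \<and> Z \<sqsubseteq>\<^bsub>J_color P\<^esub> Y"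
      using empty by (intro bexI[of _ "{}"]) simp_all
    show "\<exists>Z\<in>carrier (J_color P). X \<sqsubseteq>\<^bsub>J_color P\<^esub> Z \<and> Y \<sqsubseteq>\<^bsub>J_color P\<^esub> Z"
      using full XY sub by (intro bexI[of _ "carrier P"]) simp_all
  qed (use fin image cover in simp_all)
qed

theorem J_color_full_length_edge_colored_sublattice:
  assumes "finite (carrier Q)" and weak: "weak_subposet Q P" and carrier: "carrier Q = carrier P"
    and color: "\<And>v. v \<in> carrier P \<Longrightarrow> vcolor Q v = vcolor P v"
  shows "full_length_sublattice (J_color P) (J_color Q)"
    and "edge_colored_sublattice (J_color P) (J_color Q)"
proof -
  have P: "partial_order P" and Q: "partial_order Q"
    using weak by (auto simp: weak_subposet_def)
  have finP: "finite (carrier P)"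
    using assms(1) carrier by simp
  interpret K: ranked_directed_poset "J_color P" card "card (carrier P)"
    by (rule ranked_directed_J_color) fact+
  interpret L: ranked_directed_poset "J_color Q" card "card (carrier P)"
    using ranked_directed_J_color[OF Q assms(1)] by (simp add: carrier)
  have sub: "order_ideals P \<subseteq> order_ideals Q"
    using weak carrier unfolding order_ideals_def weak_subposet_def by blast
  have "{} \<in> order_ideals P"
    by (simp add: order_ideals_def)
  then have lat: "sublattice (J_color P) (J_color Q)"
    using sub order_ideals_Un[of _ P] order_ideals_Int[of _ P]
    by (auto simp: sublattice_def lattice_J_color partial_order_J_color join_meet_J_color subsetD)
  moreover have "ranked (J_color P)" "ranked (J_color Q)"
    unfolding ranked_def
    using K.rank_image K.rank_cover L.rank_image L.rank_cover by blast+
  ultimately show "full_length_sublattice (J_color P) (J_color Q)"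
    by (simp add: full_length_sublattice_def K.poset_length_eq L.poset_length_eq)
  have "covers (J_color Q) X Y \<and> ecolor (J_color P) X Y = ecolor (J_color Q) X Y"
    if cov: "covers (J_color P) X Y" for X Y
  proof -
    obtain v where v: "v \<in> carrier P" "v \<notin> X" "Y = insert v X"
      using covers_J_color[OF P finP cov] .
    have "covers (J_color Q) X Y"
      using cov sub K.rank_cover[OF cov] by (intro L.covers_if_rank_Suc) (auto simp: K.covers_iff)
    \<comment> \<open>so \<open>v\<close> is the vertex that colors this edge in both lattices\<close>
    moreover have "Y - X = {v}"
      using v by auto
    ultimately show ?thesis
      using color v by simp
  qed
  with lat show "edge_colored_sublattice (J_color P) (J_color Q)"
    by (simp add: edge_colored_sublattice_def)
qed

section \<open>Join irreducible elements of a finite distributive lattice\<close>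

lemma covers_in_carrier:
  "covers P x y \<Longrightarrow> x \<in> carrier P" "covers P x y \<Longrightarrow> y \<in> carrier P"
  by (simp_all add: covers_def)

lemma join_irreducible_unique_lower_cover:
  assumes "x \<in> join_irreducibles P" "covers P v x" "covers P v' x"
  shows "v' = v"
  using assms by (auto simp: join_irreducibles_def)

lemma j_color_simps [simp]:
  "carrier (j_color P) = join_irreducibles P" "eq (j_color P) = (=)" "le (j_color P) = le P"
  by (simp_all add: j_color_def)

lemma vcolor_j_color:
  assumes "x \<in> join_irreducibles P" "covers P v x"
  shows "vcolor (j_color P) x = ecolor P v x"
proof -
  have "(THE x'. covers P x' x) = v"
    using assms by (intro the_equality) (auto intro: join_irreducible_unique_lower_cover)
  then show ?thesis
    by (simp add: j_color_def)
qed

lemma (in partial_order) below_join_irreducible: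
  assumes "finite (carrier L)" "x \<in> join_irreducibles L" "covers L x' x"
    and "z \<in> carrier L" "z \<sqsubseteq> x" "z \<noteq> x"
  shows "z \<sqsubseteq> x'"
proof -
  have "x \<in> carrier L"
    using assms(2) by (simp add: join_irreducibles_def)
  then obtain v where "covers L v x" "z \<sqsubseteq> v"
    using obtains_lower_cover assms by metis
  then show ?thesis
    using join_irreducible_unique_lower_cover assms by metis
qed

text \<open>A minimal element below \<open>b\<close> and not below \<open>a\<close> is join irreducible: everything strictly below it is
  below \<open>a\<close>, so it is not a join of two smaller elements.\<close>

lemma (in lattice) join_irreducible_separates:
  assumes "finite (carrier L)" "a \<in> carrier L" "b \<in> carrier L" "\<not> b \<sqsubseteq> a"
  obtains x where "x \<in> join_irreducibles L" "x \<sqsubseteq> b" "\<not> x \<sqsubseteq> a"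
proof -
  let ?A = "{z \<in> carrier L. z \<sqsubseteq> b \<and> \<not> z \<sqsubseteq> a}"
  have "finite ?A" "?A \<subseteq> carrier L" "?A \<noteq> {}"
    using assms by auto
  then obtain x where "x \<in> ?A" and min: "\<And>z. z \<in> ?A \<Longrightarrow> z \<sqsubseteq> x \<Longrightarrow> z = x"
    by (rule obtains_minimal) blast
  then have x: "x \<in> carrier L" "x \<sqsubseteq> b" "\<not> x \<sqsubseteq> a"
    by auto
  have below: "v \<sqsubseteq> a" if "v \<in> carrier L" "v \<sqsubseteq> x" "v \<noteq> x" for v
    using min[of v] that x assms(3) le_trans[of v x b] by auto
  have "x \<sqinter> a \<noteq> x"
    using x assms(2) meet_right[of x a] by auto
  then obtain v where v: "covers L v x"
    using obtains_lower_cover[OF assms(1) meet_closed[OF x(1) assms(2)] x(1)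
        meet_left[OF x(1) assms(2)]] by blast
  have "u = v" if u: "covers L u x" for u
  proof (rule ccontr)
    assume "u \<noteq> v"
    have uv: "u \<in> carrier L" "v \<in> carrier L" "u \<sqsubseteq> x" "v \<sqsubseteq> x" "u \<noteq> x" "v \<noteq> x"
      using u v by (auto simp: covers_iff)
    then have "u \<squnion> v \<sqsubseteq> x" "u \<squnion> v \<sqsubseteq> a" "u \<sqsubseteq> u \<squnion> v" "v \<sqsubseteq> u \<squnion> v"
      using below x assms(2) join_left join_right by (auto intro: join_le)
    moreover from this have "u \<squnion> v \<noteq> x"
      using x by auto
    ultimately have "u \<squnion> v = u" "u \<squnion> v = v"
      using u v uv join_closed unfolding covers_iff by metis+
    then show False
      using \<open>u \<noteq> v\<close> by simp
  qed
  then have "x \<in> join_irreducibles L"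
    using v x by (auto simp: join_irreducibles_def)
  then show ?thesis
    using that x by blast
qed

locale finite_distributive_lattice = distributive_lattice +
  assumes finite_carrier: "finite (carrier L)"
begin

lemma join_prime:
  assumes "x \<in> join_irreducibles L" "a \<in> carrier L" "b \<in> carrier L" "x \<sqsubseteq> a \<squnion> b"
  shows "x \<sqsubseteq> a \<or> x \<sqsubseteq> b"
proof (rule ccontr)
  assume neg: "\<not> (x \<sqsubseteq> a \<or> x \<sqsubseteq> b)"
  obtain x' where x': "covers L x' x" and x: "x \<in> carrier L"
    using assms(1) by (auto simp: join_irreducibles_def)
  have "x \<sqinter> a \<noteq> x" "x \<sqinter> b \<noteq> x"
    using neg meet_right[of x a] meet_right[of x b] x assms by auto
  then have "x \<sqinter> a \<sqsubseteq> x'" "x \<sqinter> b \<sqsubseteq> x'"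
    using below_join_irreducible[OF finite_carrier assms(1) x'] meet_left x assms by auto
  then have "(x \<sqinter> a) \<squnion> (x \<sqinter> b) \<sqsubseteq> x'"
    using x assms covers_in_carrier[OF x'] by (intro join_le) auto
  moreover have "(x \<sqinter> a) \<squnion> (x \<sqinter> b) = x"
    using meet_join_distrib[of x a b] le_iff_join[of x "a \<squnion> b"] x assms by simp
  ultimately show False
    using x' le_antisym[of x x'] by (auto simp: covers_iff)
qed

text \<open>Joining either element with \<open>v\<close> gives \<open>w\<close>, so by join primeness each is below the other.\<close>

lemma join_irreducible_of_cover_unique:
  assumes cov: "covers L v w"
    and x: "x \<in> join_irreducibles L" "x \<sqsubseteq> w" "\<not> x \<sqsubseteq> v"
    and y: "y \<in> join_irreducibles L" "y \<sqsubseteq> w" "\<not> y \<sqsubseteq> v"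
  shows "x = y"
proof -
  have vw: "v \<in> carrier L" "w \<in> carrier L" "v \<sqsubseteq> w"
    using cov by (auto simp: covers_iff)
  have step: "s \<sqsubseteq> t" if s: "s \<in> join_irreducibles L" "s \<sqsubseteq> w" "\<not> s \<sqsubseteq> v"
    and t: "t \<in> join_irreducibles L" "t \<sqsubseteq> w" "\<not> t \<sqsubseteq> v" for s t
  proof -
    have carr: "s \<in> carrier L" "t \<in> carrier L"
      using s t by (auto simp: join_irreducibles_def)
    have "v \<squnion> t \<noteq> v"
      using join_right[of v t] carr vw t by auto
    moreover have "v \<squnion> t \<sqsubseteq> w" "v \<sqsubseteq> v \<squnion> t"
      using carr vw t by (auto intro: join_le join_left)
    ultimately have "v \<squnion> t = w"
      using cov carr vw join_closed unfolding covers_iff by metis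
    then show ?thesis
      using join_prime[of s v t] s carr vw by auto
  qed
  show ?thesis
    using step[OF x y] step[OF y x] x y by (auto simp: join_irreducibles_def)
qed

text \<open>This is the modular law, the form in which distributivity controls the interval from \<open>c\<close> to
  \<open>c \<squnion> x\<close>.\<close>

lemma between_join:
  assumes "c \<in> carrier L" "x \<in> carrier L" "z \<in> carrier L" "c \<sqsubseteq> z" "z \<sqsubseteq> c \<squnion> x"
  shows "z = c \<squnion> (z \<sqinter> x)"
proof -
  have "z = z \<sqinter> (c \<squnion> x)"
    using assms le_iff_join[of z "c \<squnion> x"] by simp
  also have "\<dots> = (z \<sqinter> c) \<squnion> (z \<sqinter> x)"
    using assms by (intro meet_join_distrib)
  also have "z \<sqinter> c = c"
    using assms le_iff_join[of c z] meet_comm[of L z c] by simp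
  finally show ?thesis .
qed

text \<open>An element \<open>z\<close> strictly between would be \<open>c \<squnion> (z \<sqinter> x)\<close>, but \<open>z \<sqinter> x\<close> is either \<open>x\<close> or below \<open>x'\<close>,
  hence below \<open>c\<close>.\<close>

lemma covers_join_irreducible_join:
  assumes x: "x \<in> join_irreducibles L" "covers L x' x"
    and c: "c \<in> carrier L" "x' \<sqsubseteq> c" "\<not> x \<sqsubseteq> c"
  shows "covers L c (c \<squnion> x)"
proof -
  have carr: "x \<in> carrier L" "x' \<in> carrier L"
    using x by (auto simp: covers_iff)
  have "z = c \<or> z = c \<squnion> x" if z: "z \<in> carrier L" "c \<sqsubseteq> z" "z \<sqsubseteq> c \<squnion> x" for z
  proof (cases "z \<sqinter> x = x")
    case True
    then show ?thesis
      using between_join[of c x z] z c carr by simp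
  next
    case False
    then have "z \<sqinter> x \<sqsubseteq> x'"
      using below_join_irreducible[OF finite_carrier x] z carr meet_right by simp
    then have "z \<sqinter> x \<sqsubseteq> c"
      using le_trans[of "z \<sqinter> x" x' c] z c carr by simp
    then have "c \<squnion> (z \<sqinter> x) = c"
      using le_iff_meet[of "z \<sqinter> x" c] z c carr join_comm[of L c] by simp
    then show ?thesis
      using between_join[of c x z] z c carr by simp
  qed
  moreover have "c \<noteq> c \<squnion> x"
    using join_right[of c x] c carr by auto
  ultimately show ?thesis
    using c carr join_left by (auto simp: covers_iff)
qed

lemma covers_join:
  assumes cov: "covers L d c" and x: "x \<in> carrier L" and nle: "\<not> c \<sqsubseteq> d \<squnion> x"
  shows "covers L (d \<squnion> x) (c \<squnion> x)"
proof -
  have dc: "d \<in> carrier L" "c \<in> carrier L" "d \<sqsubseteq> c"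
    using cov by (auto simp: covers_iff)
  have "z = d \<squnion> x \<or> z = c \<squnion> x" if z: "z \<in> carrier L" "d \<squnion> x \<sqsubseteq> z" "z \<sqsubseteq> c \<squnion> x" for z
  proof -
    have "x \<sqsubseteq> z" "d \<sqsubseteq> z"
      using z dc x le_trans[of x "d \<squnion> x" z] le_trans[of d "d \<squnion> x" z] join_left join_right by auto
    then have "z = x \<squnion> (z \<sqinter> c)"
      using between_join[of x c z] z dc x by (simp add: join_comm)
    moreover have "z \<sqinter> c = d \<or> z \<sqinter> c = c"
      using cov meet_le[of d z c] meet_right[of z c] \<open>d \<sqsubseteq> z\<close> z dc meet_closed
      unfolding covers_iff by metis
    ultimately show ?thesis
      using join_comm by metis
  qed
  moreover have "d \<squnion> x \<noteq> c \<squnion> x"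
    using nle join_left[of c x] dc x by auto
  moreover have "d \<squnion> x \<sqsubseteq> c \<squnion> x"
    using dc x join_left[of c x] join_right[of c x] le_trans[of d c "c \<squnion> x"]
    by (intro join_le) auto
  ultimately show ?thesis
    using dc x by (auto simp: covers_iff)
qed

text \<open>The edge from \<open>x'\<close> to \<open>x\<close> is carried up a saturated chain from \<open>x'\<close> to \<open>c\<close>. For consecutive
  elements \<open>d\<close>, \<open>c\<close> of the chain, \<open>d\<close>, \<open>d \<squnion> x\<close>, \<open>c\<close> and \<open>c \<squnion> x\<close> form a diamond in which the edges
  from \<open>d\<close> to \<open>d \<squnion> x\<close> and from \<open>c\<close> to \<open>c \<squnion> x\<close> are opposite.\<close>

lemma diamond_translate_color:
  assumes diamond: "\<And>v s t u. covers L v s \<Longrightarrow> covers L v t \<Longrightarrow> covers L s u \<Longrightarrow> covers L t u \<Longrightarrow>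
      s \<noteq> t \<Longrightarrow> color v s = color t u"
    and x: "x \<in> join_irreducibles L" "covers L x' x"
    and c: "c \<in> carrier L" "x' \<sqsubseteq> c" "\<not> x \<sqsubseteq> c"
  shows "color c (c \<squnion> x) = color x' x"
proof -
  have carr: "x \<in> carrier L" "x' \<in> carrier L" and "x' \<sqsubseteq> x"
    using x by (auto simp: covers_iff)
  have "\<not> x \<sqsubseteq> c \<longrightarrow> color c (c \<squnion> x) = color x' x"
    using finite_carrier carr(2) c(1,2)
  proof (induction rule: saturated_chain_induct)
    case base
    then show ?case
      using le_iff_meet[of x' x] carr \<open>x' \<sqsubseteq> x\<close> by simp
  next
    case (step d c)
    have dc: "d \<in> carrier L" "c \<in> carrier L" "d \<sqsubseteq> c" "d \<noteq> c"
      and between: "\<And>z. z \<in> carrier L \<Longrightarrow> d \<sqsubseteq> z \<Longrightarrow> z \<sqsubseteq> c \<Longrightarrow> z = d \<or> z = c"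
      using step.hyps by (auto simp: covers_iff)
    show ?case
    proof
      assume nle: "\<not> x \<sqsubseteq> c"
      then have nle': "\<not> x \<sqsubseteq> d"
        using le_trans[of x d c] dc carr by auto
      have "x' \<sqsubseteq> c"
        using le_trans[of x' d c] step.hyps dc carr by auto
      have cov1: "covers L d (d \<squnion> x)" and cov2: "covers L c (c \<squnion> x)"
        using covers_join_irreducible_join[OF x] dc nle nle' \<open>x' \<sqsubseteq> c\<close> step.hyps by auto
      have neq: "d \<squnion> x \<noteq> c"
        using nle join_right[of d x] dc carr by auto
      have "\<not> c \<sqsubseteq> d \<squnion> x"
        using cov1 dc neq unfolding covers_iff by metis
      then have "covers L (d \<squnion> x) (c \<squnion> x)"
        using covers_join step.hyps carr by blast
      then have "color d (d \<squnion> x) = color c (c \<squnion> x)"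
        using diamond cov1 cov2 step.hyps(1) neq by blast
      then show "color c (c \<squnion> x) = color x' x"
        using step.IH nle' by simp
    qed
  qed
  then show ?thesis
    using c by simp
qed

text \<open>By uniqueness of the crossing join irreducible, \<open>x'\<close> is already below \<open>v\<close>, so the edge from \<open>v\<close> to
  \<open>w = v \<squnion> x\<close> is a translate of the edge from \<open>x'\<close> to \<open>x\<close>.\<close>

lemma color_of_cover:
  assumes diamond: "\<And>v s t u. covers L v s \<Longrightarrow> covers L v t \<Longrightarrow> covers L s u \<Longrightarrow> covers L t u \<Longrightarrow>
      s \<noteq> t \<Longrightarrow> color v s = color t u"
    and cov: "covers L v w"
    and x: "x \<in> join_irreducibles L" "covers L x' x" and xw: "x \<sqsubseteq> w" "\<not> x \<sqsubseteq> v"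
  shows "color v w = color x' x"
proof -
  have vw: "v \<in> carrier L" "w \<in> carrier L" "v \<sqsubseteq> w"
    using cov by (auto simp: covers_iff)
  have xx': "x \<in> carrier L" "x' \<in> carrier L" "x' \<sqsubseteq> x" "x' \<noteq> x"
    using x by (auto simp: covers_iff)
  have "x' \<sqsubseteq> v"
  proof (rule ccontr)
    assume "\<not> x' \<sqsubseteq> v"
    then obtain y where y: "y \<in> join_irreducibles L" "y \<sqsubseteq> x'" "\<not> y \<sqsubseteq> v"
      using join_irreducible_separates[OF finite_carrier vw(1) xx'(2)] by blast
    then have "y \<in> carrier L"
      by (simp add: join_irreducibles_def)
    then have "y \<sqsubseteq> x" "y \<sqsubseteq> w"
      using y xx' xw vw le_trans[of y x' x] le_trans[of y x w] by auto
    then have "x = y"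
      using join_irreducible_of_cover_unique[OF cov x(1) xw] y by blast
    then show False
      using y xx' le_antisym by blast
  qed
  moreover have "v \<squnion> x = w"
  proof -
    have "v \<squnion> x \<noteq> v"
      using join_right[of v x] vw xx' xw by auto
    moreover have "v \<squnion> x \<sqsubseteq> w" "v \<sqsubseteq> v \<squnion> x"
      using vw xx' xw by (auto intro: join_le join_left)
    ultimately show ?thesis
      using cov vw xx' join_closed unfolding covers_iff by metis
  qed
  ultimately show ?thesis
    using diamond_translate_color[OF diamond x vw(1)] xw by simp
qed

end

section \<open>Full-length sublattices\<close>

text \<open>On \<open>K\<close> the rank function \<open>\<rho>\<close> of \<open>L\<close> increases along each edge of \<open>K\<close> by at least one. A saturated
  chain of \<open>K\<close> from bottom to top has as many edges as \<open>\<rho>\<close> has room to grow, so every increase is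
  exactly one, and the ranks also agree at the bottom.\<close>

lemma full_length_common_rank:
  assumes "finite (carrier L)" and full: "full_length_sublattice K L"
  obtains \<rho> l where "ranked_directed_poset K \<rho> l" "ranked_directed_poset L \<rho> l"
proof -
  have "lattice L" "partial_order K" and sub: "carrier K \<subseteq> carrier L"
    and le_iff: "\<And>x y. x \<in> carrier K \<Longrightarrow> y \<in> carrier K \<Longrightarrow> x \<sqsubseteq>\<^bsub>K\<^esub> y \<longleftrightarrow> x \<sqsubseteq>\<^bsub>L\<^esub> y"
    and closed: "\<And>x y. x \<in> carrier K \<Longrightarrow> y \<in> carrier K \<Longrightarrow> x \<squnion>\<^bsub>L\<^esub> y \<in> carrier K \<and> x \<sqinter>\<^bsub>L\<^esub> y \<in> carrier K"
    using full by (auto simp: full_length_sublattice_def sublattice_def)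
  interpret L: lattice L by fact
  interpret K: partial_order K by fact
  have "ranked K" "ranked L"
    using full by (simp_all add: full_length_sublattice_def)
  obtain \<sigma> m where \<sigma>: "\<sigma> ` carrier K = {0..m}" "\<And>x y. covers K x y \<Longrightarrow> \<sigma> y = \<sigma> x + (1::nat)"
    using \<open>ranked K\<close> by (auto simp: ranked_def)
  obtain \<rho> l where \<rho>: "\<rho> ` carrier L = {0..l}" "\<And>x y. covers L x y \<Longrightarrow> \<rho> y = \<rho> x + (1::nat)"
    using \<open>ranked L\<close> by (auto simp: ranked_def)
  have lower: "\<exists>z\<in>carrier K. z \<sqsubseteq>\<^bsub>K\<^esub> x \<and> z \<sqsubseteq>\<^bsub>K\<^esub> y"
    and upper: "\<exists>z\<in>carrier K. x \<sqsubseteq>\<^bsub>K\<^esub> z \<and> y \<sqsubseteq>\<^bsub>K\<^esub> z" if "x \<in> carrier K" "y \<in> carrier K" for x y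
  proof -
    have xy: "x \<in> carrier L" "y \<in> carrier L"
      using that sub by auto
    show "\<exists>z\<in>carrier K. z \<sqsubseteq>\<^bsub>K\<^esub> x \<and> z \<sqsubseteq>\<^bsub>K\<^esub> y"
      using closed[OF that] that L.meet_left[OF xy] L.meet_right[OF xy]
      by (intro bexI[of _ "x \<sqinter>\<^bsub>L\<^esub> y"]) (auto simp: le_iff)
    show "\<exists>z\<in>carrier K. x \<sqsubseteq>\<^bsub>K\<^esub> z \<and> y \<sqsubseteq>\<^bsub>K\<^esub> z"
      using closed[OF that] that L.join_left[OF xy] L.join_right[OF xy]
      by (intro bexI[of _ "x \<squnion>\<^bsub>L\<^esub> y"]) (auto simp: le_iff)
  qed
  interpret K: ranked_directed_poset K \<sigma> m
    by unfold_locales (use \<sigma> lower upper finite_subset[OF sub assms(1)] in blast)+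
  interpret L: ranked_directed_poset L \<rho> l
  proof
    fix x y assume xy: "x \<in> carrier L" "y \<in> carrier L"
    show "\<exists>z\<in>carrier L. z \<sqsubseteq>\<^bsub>L\<^esub> x \<and> z \<sqsubseteq>\<^bsub>L\<^esub> y"
      using L.meet_left[OF xy] L.meet_right[OF xy] L.meet_closed[OF xy] by blast
    show "\<exists>z\<in>carrier L. x \<sqsubseteq>\<^bsub>L\<^esub> z \<and> y \<sqsubseteq>\<^bsub>L\<^esub> z"
      using L.join_left[OF xy] L.join_right[OF xy] L.join_closed[OF xy] by blast
  qed (use \<rho> assms(1) in auto)
  have "m = l"
    using full K.poset_length_eq L.poset_length_eq by (simp add: full_length_sublattice_def)
  have mono: "\<rho> u < \<rho> v" if "u \<in> carrier K" "v \<in> carrier K" "u \<sqsubseteq>\<^bsub>K\<^esub> v" "u \<noteq> v" for u v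
    using L.rank_strict_mono[of u v] that sub le_iff by auto
  obtain b where b: "b \<in> carrier K" "\<sigma> b = 0"
    by (rule K.obtains_rank_0)
  obtain t where t: "t \<in> carrier K" "\<sigma> t = m"
    by (rule K.obtains_rank_l)
  have eq: "\<rho> x = \<sigma> x" if x: "x \<in> carrier K" for x
  proof (rule antisym)
    have "b \<sqsubseteq>\<^bsub>K\<^esub> x" "x \<sqsubseteq>\<^bsub>K\<^esub> t"
      using K.rank_0_is_least[OF b x] K.rank_l_is_greatest[OF t x] .
    then have "\<sigma> x + \<rho> b \<le> \<rho> x + \<sigma> b" "\<sigma> t + \<rho> x \<le> \<rho> t + \<sigma> x"
      using K.rank_difference_le[of \<rho>, OF mono] b(1) t(1) x by blast+
    moreover have "\<rho> t \<le> m"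
      using L.rank_le[of t] t sub \<open>m = l\<close> by auto
    ultimately show "\<sigma> x \<le> \<rho> x" "\<rho> x \<le> \<sigma> x"
      using b t by simp_all
  qed
  have "ranked_directed_poset K \<rho> l"
  proof
    show "\<rho> ` carrier K = {0..l}"
      using eq \<sigma>(1) \<open>m = l\<close> by simp
    show "\<rho> y = \<rho> x + 1" if "covers K x y" for x y
      using \<sigma>(2)[OF that] eq covers_in_carrier[OF that] by simp
  qed (use lower upper K.finite_carrier in auto)
  then show ?thesis
    using that L.ranked_directed_poset_axioms by blast
qed

locale full_length_distributive = finite_distributive_lattice L for L (structure) +
  fixes K :: "('a, 'c) gorder_scheme"
  assumes full_length: "full_length_sublattice K L"
begin

lemma
  shows K_partial_order: "partial_order K"
    and K_subset: "carrier K \<subseteq> carrier L"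
    and K_le_iff: "x \<in> carrier K \<Longrightarrow> y \<in> carrier K \<Longrightarrow> x \<sqsubseteq>\<^bsub>K\<^esub> y \<longleftrightarrow> x \<sqsubseteq> y"
    and K_join_closed: "x \<in> carrier K \<Longrightarrow> y \<in> carrier K \<Longrightarrow> x \<squnion> y \<in> carrier K"
    and K_meet_closed: "x \<in> carrier K \<Longrightarrow> y \<in> carrier K \<Longrightarrow> x \<sqinter> y \<in> carrier K"
  using full_length by (auto simp: full_length_sublattice_def sublattice_def)

sublocale K: partial_order K
  by (rule K_partial_order)

lemma K_finite: "finite (carrier K)"
  using K_subset finite_carrier by (rule finite_subset)

lemma K_between:
  assumes "covers K u w" "z \<in> carrier K" "u \<sqsubseteq> z" "z \<sqsubseteq> w"
  shows "z = u \<or> z = w"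
  using assms covers_in_carrier[OF assms(1)] unfolding K.covers_iff by (simp add: K_le_iff)

lemma K_covers_imp_covers:
  assumes "covers K x y"
  shows "covers L x y"
proof -
  obtain \<rho> l where "ranked_directed_poset K \<rho> l" "ranked_directed_poset L \<rho> l"
    using full_length_common_rank[OF finite_carrier full_length] .
  then interpret RK: ranked_directed_poset K \<rho> l + RL: ranked_directed_poset L \<rho> l .
  show ?thesis
    using assms K_subset RK.rank_cover[OF assms]
    by (intro RL.covers_if_rank_Suc) (auto simp: K.covers_iff K_le_iff)
qed

lemma K_contains_top:
  obtains t where "t \<in> carrier K" "\<And>x. x \<in> carrier L \<Longrightarrow> x \<sqsubseteq> t"
proof -
  obtain \<rho> l where "ranked_directed_poset K \<rho> l" "ranked_directed_poset L \<rho> l"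
    using full_length_common_rank[OF finite_carrier full_length] .
  then interpret RK: ranked_directed_poset K \<rho> l + RL: ranked_directed_poset L \<rho> l .
  obtain t where "t \<in> carrier K" "\<rho> t = l"
    by (rule RK.obtains_rank_l)
  then show ?thesis
    using K_subset by (intro that[of t] RL.rank_l_is_greatest) auto
qed

lemma K_contains_bottom:
  obtains b where "b \<in> carrier K" "\<And>x. x \<in> carrier L \<Longrightarrow> b \<sqsubseteq> x"
proof -
  obtain \<rho> l where "ranked_directed_poset K \<rho> l" "ranked_directed_poset L \<rho> l"
    using full_length_common_rank[OF finite_carrier full_length] .
  then interpret RK: ranked_directed_poset K \<rho> l + RL: ranked_directed_poset L \<rho> l .
  obtain b where "b \<in> carrier K" "\<rho> b = 0"
    by (rule RK.obtains_rank_0)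
  then show ?thesis
    using K_subset by (intro that[of b] RL.rank_0_is_least) auto
qed

text \<open>\<open>K\<close> contains the top of \<open>L\<close> and is closed under meets, so the minimal element of \<open>K\<close> above \<open>x\<close>
  is a least one.\<close>

lemma ex1_minimal_above:
  assumes x: "x \<in> carrier L"
  shows "\<exists>!w. minimal_in K {y \<in> carrier K. x \<sqsubseteq> y} w"
    and w_elem_closed: "w_elem K L x \<in> carrier K"
    and w_elem_above: "x \<sqsubseteq> w_elem K L x"
    and w_elem_least: "\<And>y. y \<in> carrier K \<Longrightarrow> x \<sqsubseteq> y \<Longrightarrow> w_elem K L x \<sqsubseteq> y"
proof -
  let ?A = "{y \<in> carrier K. x \<sqsubseteq> y}"
  obtain t where "t \<in> carrier K" "\<And>x. x \<in> carrier L \<Longrightarrow> x \<sqsubseteq> t"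
    by (rule K_contains_top) blast
  with x have "?A \<noteq> {}"
    by blast
  moreover have "finite ?A" "?A \<subseteq> carrier L"
    using K_finite K_subset by auto
  ultimately obtain w where w: "w \<in> ?A" and min: "\<And>y. y \<in> ?A \<Longrightarrow> y \<sqsubseteq> w \<Longrightarrow> y = w"
    using obtains_minimal[of ?A] by blast
  have least: "w \<sqsubseteq> y" if y: "y \<in> carrier K" "x \<sqsubseteq> y" for y
  proof -
    have carr: "w \<in> carrier L" "y \<in> carrier L"
      using w y K_subset by auto
    then have "w \<sqinter> y \<in> ?A" "w \<sqinter> y \<sqsubseteq> w"
      using w y x K_meet_closed by (auto intro: meet_le meet_left)
    then have "w \<sqinter> y = w"
      by (rule min)
    then show ?thesis
      using meet_right[OF carr] by simp
  qed
  have unique: "minimal_in K ?A v \<longleftrightarrow> v = w" for v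
    using w min least by (auto simp: minimal_in_def K_le_iff)
  then show "\<exists>!w. minimal_in K ?A w"
    by simp
  have "w_elem K L x = w"
    unfolding w_elem_def by (rule the_equality) (simp_all add: unique)
  with w least show "w_elem K L x \<in> carrier K" "x \<sqsubseteq> w_elem K L x"
    "\<And>y. y \<in> carrier K \<Longrightarrow> x \<sqsubseteq> y \<Longrightarrow> w_elem K L x \<sqsubseteq> y"
    by auto
qed

text \<open>Since \<open>w\<^sub>x\<close> is the least element of \<open>K\<close> above \<open>x\<close>, the element \<open>x\<close> crosses the edges of \<open>K\<close> that
  end in \<open>w\<^sub>x\<close>.\<close>

lemma not_below_lower_cover:
  assumes x: "x \<in> carrier L" and cov: "covers K v (w_elem K L x)"
  shows "\<not> x \<sqsubseteq> v"
  using w_elem_least[OF x, of v] cov K_le_iff[of "w_elem K L x" v] K.le_antisym[of v]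
  by (auto simp: K.covers_iff)

text \<open>If \<open>w\<^sub>x\<close> were the bottom of \<open>K\<close>, it would be the bottom of \<open>L\<close>, and \<open>x\<close> would cover nothing. If
  \<open>w\<^sub>x\<close> covered two elements of \<open>K\<close>, it would be their join, and the join prime \<open>x\<close> would be below one
  of them.\<close>

lemma w_elem_join_irreducible:
  assumes x: "x \<in> join_irreducibles L"
  shows "w_elem K L x \<in> join_irreducibles K"
proof -
  let ?w = "w_elem K L x"
  obtain x' where x': "covers L x' x" and xL: "x \<in> carrier L"
    using x by (auto simp: join_irreducibles_def)
  note w = w_elem_closed[OF xL] w_elem_above[OF xL]
  have wL: "?w \<in> carrier L"
    using w K_subset by auto
  obtain b where b: "b \<in> carrier K" "\<And>x. x \<in> carrier L \<Longrightarrow> b \<sqsubseteq> x"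
    by (rule K_contains_bottom) blast
  have "b \<noteq> ?w"
  proof
    assume "b = ?w"
    then have "x = b"
      using w b(2)[OF xL] xL wL le_antisym[of x b] by simp
    then have "x' = x"
      using x' b(2)[of x'] le_antisym[of x' x] by (simp add: covers_iff)
    then show False
      using x' by (simp add: covers_iff)
  qed
  moreover have "b \<sqsubseteq>\<^bsub>K\<^esub> ?w"
    using b w(1) wL by (simp add: K_le_iff)
  ultimately obtain v where v: "covers K v ?w"
    using K.obtains_lower_cover[OF K_finite b(1) w(1)] by blast
  have "u = v" if u: "covers K u ?w" for u
  proof (rule ccontr)
    assume "u \<noteq> v"
    have uv: "u \<in> carrier K" "v \<in> carrier K" "u \<in> carrier L" "v \<in> carrier L"
      using u v K_subset by (auto simp: K.covers_iff)
    have le: "u \<sqsubseteq> ?w" "v \<sqsubseteq> ?w"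
      using u v w(1) uv by (auto simp: K.covers_iff K_le_iff)
    then have j: "u \<squnion> v \<in> carrier K" "u \<squnion> v \<sqsubseteq> ?w" "u \<sqsubseteq> u \<squnion> v" "v \<sqsubseteq> u \<squnion> v"
      using uv wL by (auto intro: K_join_closed join_le join_left join_right)
    have "u \<squnion> v = u \<or> u \<squnion> v = ?w" "u \<squnion> v = v \<or> u \<squnion> v = ?w"
      using K_between[OF u] K_between[OF v] j by simp_all
    then have "u \<squnion> v = ?w"
      using \<open>u \<noteq> v\<close> by auto
    then have "x \<sqsubseteq> u \<or> x \<sqsubseteq> v"
      using join_prime[OF x uv(3,4)] w by simp
    then show False
      using not_below_lower_cover[OF xL] u v by blast
  qed
  then show ?thesis
    using v w(1) by (auto simp: join_irreducibles_def)
qed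

lemma w_elem_lower_cover:
  assumes x: "x \<in> join_irreducibles L"
  obtains v where "covers K v (w_elem K L x)" "covers L v (w_elem K L x)"
    "x \<sqsubseteq> w_elem K L x" "\<not> x \<sqsubseteq> v"
proof -
  obtain v where v: "covers K v (w_elem K L x)"
    using w_elem_join_irreducible[OF x] by (auto simp: join_irreducibles_def)
  have "x \<in> carrier L"
    using x by (simp add: join_irreducibles_def)
  then show ?thesis
    using that[OF v K_covers_imp_covers[OF v]] w_elem_above not_below_lower_cover[OF _ v] by blast
qed

text \<open>The inverse sends \<open>w\<close> to the join irreducible \<open>x\<close> of \<open>L\<close> that crosses the unique edge of \<open>K\<close> from
  some \<open>v\<close> to \<open>w\<close>. Here \<open>w\<^sub>x = w\<close>, because otherwise \<open>w\<^sub>x\<close>, and with it \<open>x\<close>, would be below \<open>v\<close>.\<close>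

lemma w_elem_bij: "bij_betw (w_elem K L) (join_irreducibles L) (join_irreducibles K)"
proof (rule bij_betw_imageI)
  show "inj_on (w_elem K L) (join_irreducibles L)"
  proof (rule inj_onI)
    fix x y
    assume x: "x \<in> join_irreducibles L" and y: "y \<in> join_irreducibles L"
      and eq: "w_elem K L x = w_elem K L y"
    obtain v where v: "covers K v (w_elem K L x)" "covers L v (w_elem K L x)"
      "x \<sqsubseteq> w_elem K L x" "\<not> x \<sqsubseteq> v"
      using w_elem_lower_cover[OF x] .
    have "y \<in> carrier L"
      using y by (simp add: join_irreducibles_def)
    then have "y \<sqsubseteq> w_elem K L x" "\<not> y \<sqsubseteq> v"
      using w_elem_above not_below_lower_cover v(1) eq by auto
    then show "x = y"
      using join_irreducible_of_cover_unique[OF v(2)] v x y by blast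
  qed
  have "w \<in> w_elem K L ` join_irreducibles L" if w: "w \<in> join_irreducibles K" for w
  proof -
    obtain v where v: "covers K v w"
      using w by (auto simp: join_irreducibles_def)
    have vw: "v \<in> carrier L" "w \<in> carrier L" "v \<in> carrier K" "w \<in> carrier K"
      using covers_in_carrier[OF v] K_subset by auto
    have "\<not> w \<sqsubseteq> v"
      using v vw K_le_iff[of w v] K.le_antisym[of v w] by (auto simp: K.covers_iff)
    then obtain x where x: "x \<in> join_irreducibles L" "x \<sqsubseteq> w" "\<not> x \<sqsubseteq> v"
      using join_irreducible_separates[OF finite_carrier vw(1,2)] by blast
    then have xL: "x \<in> carrier L"
      by (simp add: join_irreducibles_def)
    let ?w = "w_elem K L x"
    have "?w = w"
    proof (rule ccontr)
      assume "?w \<noteq> w"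
      moreover have "?w \<sqsubseteq>\<^bsub>K\<^esub> w"
        using w_elem_least[OF xL vw(4) x(2)] w_elem_closed[OF xL] vw by (simp add: K_le_iff)
      ultimately have "?w \<sqsubseteq>\<^bsub>K\<^esub> v"
        using K.below_join_irreducible[OF K_finite w v] w_elem_closed[OF xL] by blast
      then have "x \<sqsubseteq> v"
        using w_elem_closed[OF xL] w_elem_above[OF xL] vw xL K_subset le_trans[of x ?w v]
        by (auto simp: K_le_iff)
      then show False
        using x by simp
    qed
    then show ?thesis
      using x by blast
  qed
  then show "w_elem K L ` join_irreducibles L = join_irreducibles K"
    using w_elem_join_irreducible by blast
qed

lemma w_elem_mono:
  assumes "u \<in> carrier L" "v \<in> carrier L" "u \<sqsubseteq> v"
  shows "w_elem K L u \<sqsubseteq>\<^bsub>K\<^esub> w_elem K L v"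
proof -
  have closed: "w_elem K L u \<in> carrier K" "w_elem K L v \<in> carrier K"
    using assms w_elem_closed by auto
  then have "w_elem K L v \<in> carrier L"
    using K_subset by blast
  then have "u \<sqsubseteq> w_elem K L v"
    using le_trans[OF assms(3) w_elem_above[OF assms(2)] assms(1,2)] by simp
  then show ?thesis
    using w_elem_least[OF assms(1) closed(2)] closed by (simp add: K_le_iff)
qed

end

text \<open>Both colors are that of the edge of \<open>K\<close> ending in \<open>w\<^sub>x\<close>: for \<open>w\<^sub>x\<close> by definition, for \<open>x\<close> because
  \<open>x\<close> crosses it.\<close>

lemma w_elem_color:
  fixes L K :: "('a, 'i) ecposet"
  assumes "full_length_distributive L K" "diamond_colored L"
    and inherit: "\<And>x y. covers K x y \<Longrightarrow> ecolor K x y = ecolor L x y"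
    and x: "x \<in> join_irreducibles L"
  shows "vcolor (j_color K) (w_elem K L x) = vcolor (j_color L) x"
proof -
  interpret full_length_distributive L K by fact
  obtain v where v: "covers K v (w_elem K L x)" "covers L v (w_elem K L x)"
    "x \<sqsubseteq>\<^bsub>L\<^esub> w_elem K L x" "\<not> x \<sqsubseteq>\<^bsub>L\<^esub> v"
    using w_elem_lower_cover[OF x] .
  obtain x' where x': "covers L x' x"
    using x by (auto simp: join_irreducibles_def)
  have "ecolor L p s = ecolor L t u"
    if "covers L p s" "covers L p t" "covers L s u" "covers L t u" "s \<noteq> t" for p s t u
    using assms(2)[unfolded diamond_colored_def, rule_format, of p s t u] that by simp
  then have "ecolor L v (w_elem K L x) = ecolor L x' x"
    by (rule color_of_cover[OF _ v(2) x x' v(3,4)])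
  then show ?thesis
    using vcolor_j_color[OF w_elem_join_irreducible[OF x] v(1)] vcolor_j_color[OF x x']
      inherit[OF v(1)] by simp
qed

section \<open>Full-length sublattices and weak subposets\<close>

lemma transported_order:
  fixes P Q :: "('a, 'i) vcposet"
  assumes P: "partial_order P" and Q: "partial_order Q"
    and bij: "bij_betw \<phi> (carrier Q) (carrier P)"
    and color: "\<forall>x\<in>carrier Q. vcolor P (\<phi> x) = vcolor Q x"
    and mono: "\<forall>u\<in>carrier Q. \<forall>v\<in>carrier Q. u \<sqsubseteq>\<^bsub>Q\<^esub> v \<longrightarrow> \<phi> u \<sqsubseteq>\<^bsub>P\<^esub> \<phi> v"
  defines "Q' \<equiv> P\<lparr>le := \<lambda>a b. \<exists>u\<in>carrier Q. \<exists>v\<in>carrier Q. a = \<phi> u \<and> b = \<phi> v \<and> u \<sqsubseteq>\<^bsub>Q\<^esub> v\<rparr>"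
  shows transported_le_iff:
      "u \<in> carrier Q \<Longrightarrow> v \<in> carrier Q \<Longrightarrow> \<phi> u \<sqsubseteq>\<^bsub>Q'\<^esub> \<phi> v \<longleftrightarrow> u \<sqsubseteq>\<^bsub>Q\<^esub> v"
    and transported_weak_subposet: "weak_subposet Q' P"
    and transported_isomorphic: "vc_isomorphic Q' Q"
proof -
  interpret P: partial_order P by fact
  interpret Q: partial_order Q by fact
  have inj: "\<phi> u = \<phi> v \<longleftrightarrow> u = v" if "u \<in> carrier Q" "v \<in> carrier Q" for u v
    using bij that by (auto simp: bij_betw_def inj_on_def)
  have surj: "\<exists>u\<in>carrier Q. a = \<phi> u" if "a \<in> carrier P" for a
    using bij that by (auto simp: bij_betw_def)
  have [simp]: "carrier Q' = carrier P" "vcolor Q' = vcolor P" "eq Q' = (=)"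
    by (simp_all add: Q'_def P.eq_is_equal)
  have le_iff: "\<phi> u \<sqsubseteq>\<^bsub>Q'\<^esub> \<phi> v \<longleftrightarrow> u \<sqsubseteq>\<^bsub>Q\<^esub> v" if "u \<in> carrier Q" "v \<in> carrier Q" for u v
    using that inj by (auto simp: Q'_def)
  then show "u \<in> carrier Q \<Longrightarrow> v \<in> carrier Q \<Longrightarrow> \<phi> u \<sqsubseteq>\<^bsub>Q'\<^esub> \<phi> v \<longleftrightarrow> u \<sqsubseteq>\<^bsub>Q\<^esub> v" .
  interpret Q': partial_order Q'
  proof
    fix a b c
    show "a \<sqsubseteq>\<^bsub>Q'\<^esub> a" if "a \<in> carrier Q'"
      using surj[of a] that le_iff by auto
    show "a .=\<^bsub>Q'\<^esub> b" if "a \<sqsubseteq>\<^bsub>Q'\<^esub> b" "b \<sqsubseteq>\<^bsub>Q'\<^esub> a" "a \<in> carrier Q'" "b \<in> carrier Q'"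
      using surj[of a] surj[of b] that le_iff by (auto dest: Q.le_antisym)
    show "a \<sqsubseteq>\<^bsub>Q'\<^esub> c" if "a \<sqsubseteq>\<^bsub>Q'\<^esub> b" "b \<sqsubseteq>\<^bsub>Q'\<^esub> c" "a \<in> carrier Q'" "b \<in> carrier Q'" "c \<in> carrier Q'"
      using surj[of a] surj[of b] surj[of c] that le_iff by (auto intro: Q.le_trans)
  qed auto
  show "weak_subposet Q' P"
    using P Q'.partial_order_axioms mono by (auto simp: weak_subposet_def Q'_def)
  let ?f = "the_inv_into (carrier Q) \<phi>"
  have "inj_on \<phi> (carrier Q)"
    using bij by (simp add: bij_betw_def)
  then have f: "?f (\<phi> u) = u" if "u \<in> carrier Q" for u
    using that by (rule the_inv_into_f_f)
  have "?f a \<sqsubseteq>\<^bsub>Q\<^esub> ?f b \<longleftrightarrow> a \<sqsubseteq>\<^bsub>Q'\<^esub> b" if "a \<in> carrier Q'" "b \<in> carrier Q'" for a b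
    using surj[of a] surj[of b] that f le_iff by auto
  then have "order_emb Q' Q ?f"
    using Q'.weak_partial_order_axioms Q.weak_partial_order_axioms by (simp add: order_emb_def)
  moreover have "vcolor Q (?f a) = vcolor Q' a" if "a \<in> carrier Q'" for a
    using surj[of a] that f color by auto
  ultimately show "vc_isomorphic Q' Q"
    unfolding vc_isomorphic_def using bij_betw_the_inv_into[OF bij] by auto
qed

lemma partial_order_j_color:
  assumes "partial_order L"
  shows "partial_order (j_color L)"
proof -
  interpret partial_order L by fact
  have "join_irreducibles L \<subseteq> carrier L"
    by (auto simp: join_irreducibles_def)
  then show ?thesis
    by unfold_locales (auto intro: le_trans dest: subsetD)
qed

text \<open>What remains of the order ideal part is that the color classes determine the vertices and their
  colors, because every color lies in \<open>I\<close>.\<close>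

theorem theorem2p11:
  shows
    "(\<forall>(I :: 'i set) (P :: ('a, 'i) vcposet) (Q :: ('a, 'i) vcposet).
        vertex_colored_poset I P \<and> vertex_colored_poset I Q \<and>
        (\<forall>i\<in>I. {x \<in> carrier Q. vcolor Q x = i} = {x \<in> carrier P. vcolor P x = i}) \<and>
        weak_subposet Q P \<longrightarrow>
        (let K = J_color P; L = J_color Q in
           full_length_sublattice K L \<and> edge_colored_sublattice K L))
     \<and>
     (\<forall>(I :: 'j set) (L :: ('b, 'j) ecposet) (K :: ('b, 'j) ecposet).
        diamond_colored_distributive_lattice I L \<and>
        full_length_sublattice K L \<and>
        (\<forall>x y. covers K x y \<longrightarrow> ecolor K x y = ecolor L x y) \<longrightarrow>
        (let Q = j_color L; P = j_color K; \<phi> = w_elem K L;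
             Q' = P\<lparr>le := (\<lambda>a b. \<exists>u\<in>carrier Q. \<exists>v\<in>carrier Q. a = \<phi> u \<and> b = \<phi> v \<and> u \<sqsubseteq>\<^bsub>Q\<^esub> v)\<rparr>
         in
           (\<forall>x\<in>join_irreducibles L.
              (\<exists>!w. minimal_in K {y \<in> carrier K. x \<sqsubseteq>\<^bsub>L\<^esub> y} w) \<and>
              w_elem K L x \<in> join_irreducibles K)
           \<and> bij_betw \<phi> (carrier Q) (carrier P)
           \<and> (\<forall>x\<in>carrier Q. vcolor P (\<phi> x) = vcolor Q x)
           \<and> (\<forall>u\<in>carrier Q. \<forall>v\<in>carrier Q. u \<sqsubseteq>\<^bsub>Q\<^esub> v \<longrightarrow> \<phi> u \<sqsubseteq>\<^bsub>P\<^esub> \<phi> v)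
           \<and> (\<forall>u\<in>carrier Q. \<forall>v\<in>carrier Q. \<phi> u \<sqsubseteq>\<^bsub>Q'\<^esub> \<phi> v \<longleftrightarrow> u \<sqsubseteq>\<^bsub>Q\<^esub> v)
           \<and> weak_subposet Q' P
           \<and> vc_isomorphic Q' Q))"
proof (intro conjI allI impI)
  fix I :: "'i set" and P Q :: "('a, 'i) vcposet"
  assume "vertex_colored_poset I P \<and> vertex_colored_poset I Q \<and>
    (\<forall>i\<in>I. {x \<in> carrier Q. vcolor Q x = i} = {x \<in> carrier P. vcolor P x = i}) \<and> weak_subposet Q P"
  then have P: "\<forall>x\<in>carrier P. vcolor P x \<in> I"
    and Q: "finite (carrier Q)" "\<forall>x\<in>carrier Q. vcolor Q x \<in> I"
    and same: "\<And>i. i \<in> I \<Longrightarrow>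
      {x \<in> carrier Q. vcolor Q x = i} = {x \<in> carrier P. vcolor P x = i}"
    and weak: "weak_subposet Q P"
    by (auto simp: vertex_colored_poset_def)
  have "v \<in> carrier Q \<and> vcolor Q v = vcolor P v" if "v \<in> carrier P" for v
    using same[of "vcolor P v"] P that by blast
  moreover have "carrier Q \<subseteq> carrier P"
    using weak by (simp add: weak_subposet_def)
  ultimately have "carrier Q = carrier P" "\<And>v. v \<in> carrier P \<Longrightarrow> vcolor Q v = vcolor P v"
    by auto
  with Q(1) weak show "let K = J_color P; L = J_color Q in
      full_length_sublattice K L \<and> edge_colored_sublattice K L"
    by (simp add: J_color_full_length_edge_colored_sublattice)
next
  fix I :: "'j set" and L K :: "('b, 'j) ecposet"
  assume asm: "diamond_colored_distributive_lattice I L \<and> full_length_sublattice K L \<and>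
    (\<forall>x y. covers K x y \<longrightarrow> ecolor K x y = ecolor L x y)"
  then interpret distributive_lattice L
    by (simp add: diamond_colored_distributive_lattice_def)
  have pair: "full_length_distributive L K"
    using asm by unfold_locales
      (auto simp: diamond_colored_distributive_lattice_def edge_colored_poset_def)
  interpret full_length_distributive L K
    by (rule pair)
  have JI: "x \<in> carrier L" if "x \<in> join_irreducibles L" for x
    using that by (simp add: join_irreducibles_def)
  have bij: "bij_betw (w_elem K L) (carrier (j_color L)) (carrier (j_color K))"
    using w_elem_bij by simp
  have color: "\<forall>x\<in>carrier (j_color L). vcolor (j_color K) (w_elem K L x) = vcolor (j_color L) x"
    using w_elem_color[OF pair] asm by (simp add: diamond_colored_distributive_lattice_def)
  have mono: "\<forall>u\<in>carrier (j_color L). \<forall>v\<in>carrier (j_color L).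
      u \<sqsubseteq>\<^bsub>j_color L\<^esub> v \<longrightarrow> w_elem K L u \<sqsubseteq>\<^bsub>j_color K\<^esub> w_elem K L v"
    using w_elem_mono JI by simp
  note transport = transported_order[OF partial_order_j_color[OF K_partial_order]
      partial_order_j_color[OF partial_order_axioms] bij color mono]
  show "let Q = j_color L; P = j_color K; \<phi> = w_elem K L;
      Q' = P\<lparr>le := (\<lambda>a b. \<exists>u\<in>carrier Q. \<exists>v\<in>carrier Q. a = \<phi> u \<and> b = \<phi> v \<and> u \<sqsubseteq>\<^bsub>Q\<^esub> v)\<rparr>
    in (\<forall>x\<in>join_irreducibles L.
          (\<exists>!w. minimal_in K {y \<in> carrier K. x \<sqsubseteq>\<^bsub>L\<^esub> y} w) \<and> w_elem K L x \<in> join_irreducibles K)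
      \<and> bij_betw \<phi> (carrier Q) (carrier P)
      \<and> (\<forall>x\<in>carrier Q. vcolor P (\<phi> x) = vcolor Q x)
      \<and> (\<forall>u\<in>carrier Q. \<forall>v\<in>carrier Q. u \<sqsubseteq>\<^bsub>Q\<^esub> v \<longrightarrow> \<phi> u \<sqsubseteq>\<^bsub>P\<^esub> \<phi> v)
      \<and> (\<forall>u\<in>carrier Q. \<forall>v\<in>carrier Q. \<phi> u \<sqsubseteq>\<^bsub>Q'\<^esub> \<phi> v \<longleftrightarrow> u \<sqsubseteq>\<^bsub>Q\<^esub> v)
      \<and> weak_subposet Q' P
      \<and> vc_isomorphic Q' Q"
    unfolding Let_def
    using ex1_minimal_above(1)[OF JI] w_elem_join_irreducible
    by (intro conjI ballI impI bij color[rule_format] mono[rule_format] transport) assumption+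
qed

end
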